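(* Let $\Omega\subset\mathbb C^n$ be any bounded open convex set and $1<q\le\infty$. Then the set of functions $g\in\bigcap_{p<q}\mathcal{O}L^p(\Omega)$ which are totally unbounded in $\Omega$ is dense and $G_\delta$ in $\bigcap_{p<q}\mathcal{O}L^p(\Omega)$.
   Context: For a bounded open $\Omega$ and $p\ge1$, $\mathcal{O}L^p(\Omega)$ is the Banach space of holomorphic $f$ on $\Omega$ with $\|f\|_p=(\int_\Omega|f|^p\,dv)^{1/p}<\infty$. For $1<q\le\infty$, $\bigcap_{p<q}\mathcal{O}L^p(\Omega)$ carries the complete metric $d(f,g)=\sum_j2^{-j}\frac{\|f-g\|_{p_j}}{1+\|f-g\|_{p_j}}$ with $1<p_1<p_2<\dots$, $p_j\to q$; convergence means $\|f_k-f\|_p\to0$ for all $p<q$. A holomorphic $f$ is totally unbounded in $\Omega$ if for every $w\in\partial\Omega$, $\delta>0$ and every connected component $E$ of $B(w,\delta)\cap\Omega$, $\sup_E|f|=\infty$. *)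

theory Defs
  imports "HOL-Analysis.Analysis"
begin

definition holo_on :: "(complex ^ 'n::finite) set \<Rightarrow> (complex ^ 'n \<Rightarrow> complex) \<Rightarrow> bool" where
  "holo_on \<Omega> f \<longleftrightarrow> (\<forall>z\<in>\<Omega>. \<exists>L. (f has_derivative L) (at z) \<and> (\<forall>c v. L (c *s v) = c * L v))"

definition lp_int :: "real \<Rightarrow> (complex ^ 'n::finite) set \<Rightarrow> (complex ^ 'n \<Rightarrow> complex) \<Rightarrow> ennreal" where
  "lp_int p \<Omega> f = (\<integral>\<^sup>+ z \<in> \<Omega>. ennreal (norm (f z) powr p) \<partial>lebesgue)"

definition lp_norm :: "real \<Rightarrow> (complex ^ 'n::finite) set \<Rightarrow> (complex ^ 'n \<Rightarrow> complex) \<Rightarrow> real" where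
  "lp_norm p \<Omega> f = (enn2real (lp_int p \<Omega> f)) powr (1 / p)"

text \<open>The space of holomorphic f on Omega with f in L^p for all 1 <= p < q
  (functions are taken to vanish outside Omega, so that elements are determined by
  their values on Omega).\<close>
definition OLp_below :: "ereal \<Rightarrow> (complex ^ 'n::finite) set \<Rightarrow> (complex ^ 'n \<Rightarrow> complex) set" where
  "OLp_below q \<Omega> = {f. holo_on \<Omega> f \<and> (\<forall>z. z \<notin> \<Omega> \<longrightarrow> f z = 0) \<and>
      (\<forall>p::real. 1 \<le> p \<and> ereal p < q \<longrightarrow> lp_int p \<Omega> f < \<infinity>)}"

definition OLp_dist :: "(nat \<Rightarrow> real) \<Rightarrow> (complex ^ 'n::finite) set \<Rightarrow>
     (complex ^ 'n \<Rightarrow> complex) \<Rightarrow> (complex ^ 'n \<Rightarrow> complex) \<Rightarrow> real" where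
  "OLp_dist ps \<Omega> f g = (\<Sum>j. (1/2) ^ Suc j *
      (lp_norm (ps j) \<Omega> (\<lambda>z. f z - g z) / (1 + lp_norm (ps j) \<Omega> (\<lambda>z. f z - g z))))"

definition totally_unbounded :: "(complex ^ 'n::finite) set \<Rightarrow> (complex ^ 'n \<Rightarrow> complex) \<Rightarrow> bool" where
  "totally_unbounded \<Omega> f \<longleftrightarrow>
     (\<forall>w\<in>frontier \<Omega>. \<forall>\<delta>>0. \<forall>x\<in>ball w \<delta> \<inter> \<Omega>.
        \<not> bounded (f ` connected_component_set (ball w \<delta> \<inter> \<Omega>) x))"

end

theory Submission
  imports Defs "HOL-Real_Asymp.Real_Asymp"
begin

text \<open>
  By convexity, \<open>B(w,\<delta>) \<inter> \<Omega>\<close> is connected, so \<open>f\<close> is totally unbounded iff it is unbounded on each of the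
  countably many sets \<open>E = B(w,1/k) \<inter> \<Omega>\<close> with \<open>w\<close> in a countable dense subset of the boundary.
  Each set \<open>{g. \<exists>z\<in>E. |g z| > m}\<close> is open in the metric, which gives the \<open>G\<^sub>\<delta>\<close> property.

  Density needs a single totally unbounded \<open>h\<close> in the space: for fixed \<open>f\<close> and \<open>E\<close> the function
  \<open>f + c h\<close> is bounded on \<open>E\<close> for at most one \<open>c\<close>, hence arbitrarily small \<open>c\<close> work for all \<open>E\<close>.
  Let \<open>w\<^sub>j\<close> be dense in the boundary, let \<open>a\<^sub>j\<close> be the unit outer normal of a supporting hyperplane at \<open>w\<^sub>j\<close>,
  and put \<open>h = \<Sum>\<^sub>j 2\<^sup>-\<^sup>j\<^sup>-\<^sup>1 (ln C - Ln \<langle>a\<^sub>j, w\<^sub>j - z\<rangle>)\<close>. For large \<open>C\<close> every term has nonnegative real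
  part, so the singularities do not cancel. Moreover \<open>|h z| \<le> ln (C / r) + \<pi>\<close> if \<open>B(z,r) \<subseteq> \<Omega>\<close>,
  and comparing \<open>\<Omega>\<close> with its homothetic copies of ratio \<open>1 - 2\<^sup>-\<^sup>k\<close> shows that \<open>h\<close> lies in every \<open>L\<^sup>p\<close>.
\<close>

section \<open>The metric space of holomorphic functions\<close>

lemma powr_add_le_weighted:
  fixes x y A B p :: real
  assumes p: "p \<ge> 1" and x: "x \<ge> 0" and y: "y \<ge> 0" and A: "A > 0" and B: "B > 0"
  shows "(x + y) powr p \<le>
    (A + B) powr p * (A / (A + B) * (x powr p / A powr p) + B / (A + B) * (y powr p / B powr p))"
proof -
  define t where "t = B / (A + B)"
  have t: "0 < t" "t < 1" "1 - t = A / (A + B)"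
    using A B by (auto simp: t_def field_simps)
  have small: "(s * u) powr p \<le> s * u powr p" if "0 < s" "s < 1" "0 \<le> u" for s u :: real
  proof -
    have "s powr p \<le> s powr 1"
      using that p by (intro powr_mono') auto
    then show ?thesis
      using that by (simp add: powr_mult mult_right_mono)
  qed
  have conv: "((1 - t) * u + t * v) powr p \<le> (1 - t) * u powr p + t * v powr p"
    if "u \<ge> 0" "v \<ge> 0" for u v :: real
  proof (cases "u = 0 \<or> v = 0")
    case True
    then show ?thesis
      using small[of t v] small[of "1 - t" u] t that by auto
  next
    case False
    then show ?thesis
      using convex_onD[OF powr_convex[OF p], of t u v] t that by simp
  qed
  have eq: "x + y = (A + B) * ((1 - t) * (x / A) + t * (y / B))"
  proof -
    have "(1 - t) * (x / A) = x / (A + B)" "t * (y / B) = y / (A + B)"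
      unfolding t(3) unfolding t_def using A B by simp_all
    then show ?thesis
      using A B by (simp add: distrib_left)
  qed
  have "(x + y) powr p = (A + B) powr p * ((1 - t) * (x / A) + t * (y / B)) powr p"
    unfolding eq using A B x y t by (intro powr_mult)
  also have "\<dots> \<le> (A + B) powr p * ((1 - t) * (x / A) powr p + t * (y / B) powr p)"
    using A B x y by (intro mult_left_mono conv) auto
  finally show ?thesis
    using A B x y unfolding t(3) unfolding t_def by (simp add: powr_divide)
qed

lemma lp_int_eq_lp_norm_powr:
  assumes "p > 0" "lp_int p \<Omega> f < \<infinity>"
  shows "lp_int p \<Omega> f = ennreal (lp_norm p \<Omega> f powr p)"
  using assms by (simp add: lp_norm_def powr_powr ennreal_enn2real)

lemma lp_norm_nonneg [simp]: "0 \<le> lp_norm p \<Omega> f"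
  by (simp add: lp_norm_def)

lemma lp_norm_le:
  assumes "p > 0" "0 \<le> A" "lp_int p \<Omega> f \<le> ennreal (A powr p)"
  shows "lp_norm p \<Omega> f \<le> A"
proof -
  have "enn2real (lp_int p \<Omega> f) \<le> A powr p"
    using enn2real_mono[OF assms(3)] by simp
  then have "lp_norm p \<Omega> f \<le> (A powr p) powr (1 / p)"
    unfolding lp_norm_def using assms by (intro powr_mono2) auto
  then show ?thesis
    using assms by (simp add: powr_powr)
qed

lemma lp_int_add_le:
  assumes p: "p \<ge> 1" and A: "A > 0" and B: "B > 0"
    and [measurable]: "f \<in> borel_measurable lebesgue" "g \<in> borel_measurable lebesgue" "\<Omega> \<in> sets lebesgue"
    and f: "lp_int p \<Omega> f \<le> ennreal (A powr p)" and g: "lp_int p \<Omega> g \<le> ennreal (B powr p)"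
  shows "lp_int p \<Omega> (\<lambda>z. f z + g z) \<le> ennreal ((A + B) powr p)"
proof -
  define a where "a = (A + B) powr p * (A / (A + B)) / A powr p"
  define b where "b = (A + B) powr p * (B / (A + B)) / B powr p"
  have ab: "a \<ge> 0" "b \<ge> 0"
    using A B by (auto simp: a_def b_def)
  have pw: "norm (f z + g z) powr p \<le> a * norm (f z) powr p + b * norm (g z) powr p" for z
  proof -
    have "norm (f z + g z) powr p \<le> (norm (f z) + norm (g z)) powr p"
      using p by (intro powr_mono2 norm_triangle_ineq) auto
    also have "\<dots> \<le> a * norm (f z) powr p + b * norm (g z) powr p"
      using powr_add_le_weighted[OF p _ _ A B, of "norm (f z)" "norm (g z)"]
      by (simp add: a_def b_def algebra_simps)
    finally show ?thesis .
  qed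
  have "lp_int p \<Omega> (\<lambda>z. f z + g z) \<le> (\<integral>\<^sup>+ z. ennreal a * (ennreal (norm (f z) powr p) * indicator \<Omega> z)
      + ennreal b * (ennreal (norm (g z) powr p) * indicator \<Omega> z) \<partial>lebesgue)"
    unfolding lp_int_def using pw ab
    by (intro nn_integral_mono)
       (auto simp: ennreal_mult[symmetric] ennreal_plus[symmetric] indicator_def intro!: ennreal_leI
             simp del: ennreal_plus)
  also have "\<dots> = ennreal a * lp_int p \<Omega> f + ennreal b * lp_int p \<Omega> g"
    unfolding lp_int_def by (simp add: nn_integral_add nn_integral_cmult)
  also have "\<dots> \<le> ennreal a * ennreal (A powr p) + ennreal b * ennreal (B powr p)"
    using f g by (intro add_mono mult_left_mono) auto
  also have "\<dots> = ennreal (a * A powr p + b * B powr p)"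
    using ab by (simp add: ennreal_mult[symmetric] ennreal_plus[symmetric] del: ennreal_plus)
  also have "a * A powr p + b * B powr p = (A + B) powr p"
  proof -
    have "a * A powr p + b * B powr p = (A + B) powr p * ((A + B) / (A + B))"
      unfolding a_def b_def add_divide_distrib distrib_left using A B by simp
    then show ?thesis
      using A B by simp
  qed
  finally show ?thesis .
qed

lemma Minkowski_lp:
  assumes p: "p \<ge> 1"
    and meas: "f \<in> borel_measurable lebesgue" "g \<in> borel_measurable lebesgue" "\<Omega> \<in> sets lebesgue"
    and fin: "lp_int p \<Omega> f < \<infinity>" "lp_int p \<Omega> g < \<infinity>"
  shows lp_int_add_finite: "lp_int p \<Omega> (\<lambda>z. f z + g z) < \<infinity>"
    and lp_norm_triangle: "lp_norm p \<Omega> (\<lambda>z. f z + g z) \<le> lp_norm p \<Omega> f + lp_norm p \<Omega> g"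
proof -
  let ?A = "lp_norm p \<Omega> f" and ?B = "lp_norm p \<Omega> g"
  have *: "lp_int p \<Omega> (\<lambda>z. f z + g z) \<le> ennreal ((?A + e + (?B + e)) powr p)" if "e > 0" for e
  proof (rule lp_int_add_le[OF p _ _ meas])
    show "?A + e > 0" "?B + e > 0"
      using that by (simp_all add: add_nonneg_pos)
    show "lp_int p \<Omega> f \<le> ennreal ((?A + e) powr p)" "lp_int p \<Omega> g \<le> ennreal ((?B + e) powr p)"
      using that p fin by (subst lp_int_eq_lp_norm_powr; auto intro!: ennreal_leI powr_mono2)+
  qed
  show "lp_int p \<Omega> (\<lambda>z. f z + g z) < \<infinity>"
    using *[of 1] by (auto intro: le_less_trans)
  have "lp_norm p \<Omega> (\<lambda>z. f z + g z) \<le> ?A + ?B + e" if "e > 0" for e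
    using lp_norm_le[OF _ _ *[of "e/2"]] that p by (simp add: add.assoc add_nonneg_nonneg)
  then show "lp_norm p \<Omega> (\<lambda>z. f z + g z) \<le> ?A + ?B"
    by (rule field_le_epsilon)
qed

lemma lp_int_cmult:
  assumes [measurable]: "f \<in> borel_measurable lebesgue" "\<Omega> \<in> sets lebesgue"
  shows "lp_int p \<Omega> (\<lambda>z. c * f z) = ennreal (norm c powr p) * lp_int p \<Omega> f"
  unfolding lp_int_def
  by (simp add: norm_mult powr_mult ennreal_mult mult.assoc flip: nn_integral_cmult)

lemma lp_norm_cmult:
  assumes "f \<in> borel_measurable lebesgue" "\<Omega> \<in> sets lebesgue" "p > 0"
  shows "lp_norm p \<Omega> (\<lambda>z. c * f z) = norm c * lp_norm p \<Omega> f"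
  using assms by (simp add: lp_norm_def lp_int_cmult enn2real_mult powr_mult powr_powr)

lemma lp_norm_diff_commute: "lp_norm p \<Omega> (\<lambda>z. f z - g z) = lp_norm p \<Omega> (\<lambda>z. g z - f z)"
  by (simp add: lp_norm_def lp_int_def norm_minus_commute)

lemma holo_on_imp_continuous_on:
  assumes "holo_on \<Omega> f"
  shows "continuous_on \<Omega> f"
  using assms unfolding holo_on_def
  by (meson continuous_at_imp_continuous_on has_derivative_continuous)

lemma OLp_below_borel_measurable:
  assumes "f \<in> OLp_below q \<Omega>" "open \<Omega>"
  shows "f \<in> borel_measurable lebesgue"
proof -
  have "(\<lambda>z. indicator \<Omega> z *\<^sub>R f z) \<in> borel_measurable borel"
    using assms
    by (intro borel_measurable_continuous_on_indicator holo_on_imp_continuous_on)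
       (auto simp: OLp_below_def)
  also have "(\<lambda>z. indicator \<Omega> z *\<^sub>R f z) = f"
    using assms(1) by (auto simp: OLp_below_def indicator_def fun_eq_iff)
  finally show ?thesis
    by (simp add: measurable_completion)
qed

lemma OLp_below_add:
  assumes f: "f \<in> OLp_below q \<Omega>" and g: "g \<in> OLp_below q \<Omega>" and \<Omega>: "open \<Omega>"
  shows "(\<lambda>z. f z + g z) \<in> OLp_below q \<Omega>"
proof -
  have "holo_on \<Omega> (\<lambda>z. f z + g z)"
    unfolding holo_on_def
  proof
    fix z assume "z \<in> \<Omega>"
    then obtain L M where "(f has_derivative L) (at z)" "\<forall>c v. L (c *s v) = c * L v"
        "(g has_derivative M) (at z)" "\<forall>c v. M (c *s v) = c * M v"
      using f g unfolding OLp_below_def holo_on_def by blast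
    then show "\<exists>L. ((\<lambda>z. f z + g z) has_derivative L) (at z) \<and> (\<forall>c v. L (c *s v) = c * L v)"
      by (intro exI[of _ "\<lambda>v. L v + M v"]) (auto intro: has_derivative_add simp: algebra_simps)
  qed
  then show ?thesis
    using f g OLp_below_borel_measurable[OF f \<Omega>] OLp_below_borel_measurable[OF g \<Omega>] \<Omega>
    by (auto simp: OLp_below_def intro!: lp_int_add_finite[unfolded infinity_ennreal_def])
qed

lemma OLp_below_cmult:
  assumes f: "f \<in> OLp_below q \<Omega>" and \<Omega>: "open \<Omega>"
  shows "(\<lambda>z. c * f z) \<in> OLp_below q \<Omega>"
proof -
  have "holo_on \<Omega> (\<lambda>z. c * f z)"
    unfolding holo_on_def
  proof
    fix z assume "z \<in> \<Omega>"
    then obtain L where "(f has_derivative L) (at z)" "\<forall>c v. L (c *s v) = c * L v"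
      using f unfolding OLp_below_def holo_on_def by blast
    then show "\<exists>L. ((\<lambda>z. c * f z) has_derivative L) (at z) \<and> (\<forall>c v. L (c *s v) = c * L v)"
      by (intro exI[of _ "\<lambda>v. c * L v"]) (auto intro: has_derivative_mult_right simp: algebra_simps)
  qed
  then show ?thesis
    using f OLp_below_borel_measurable[OF f \<Omega>] \<Omega>
    by (auto simp: OLp_below_def lp_int_cmult ennreal_mult_less_top)
qed

lemma OLp_below_diff:
  assumes f: "f \<in> OLp_below q \<Omega>" and g: "g \<in> OLp_below q \<Omega>" and \<Omega>: "open \<Omega>"
  shows "(\<lambda>z. f z - g z) \<in> OLp_below q \<Omega>"
  using OLp_below_add[OF f OLp_below_cmult[OF g \<Omega>, of "-1"] \<Omega>] by simp

lemma lp_norm_eq_0_imp_eq_0: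
  assumes f: "f \<in> OLp_below q \<Omega>" and \<Omega>: "open \<Omega>" and p: "1 \<le> p" "ereal p < q"
    and 0: "lp_norm p \<Omega> f = 0"
  shows "f = (\<lambda>z. 0)"
proof -
  note [measurable] = OLp_below_borel_measurable[OF f \<Omega>]
  have [measurable]: "\<Omega> \<in> sets lebesgue"
    using \<Omega> by auto
  have "lp_int p \<Omega> f = 0"
    using lp_int_eq_lp_norm_powr[of p \<Omega> f] f p 0 by (auto simp: OLp_below_def)
  then have "AE z in lebesgue. ennreal (norm (f z) powr p) * indicator \<Omega> z = 0"
    unfolding lp_int_def by (subst (asm) nn_integral_0_iff_AE) auto
  then have "AE z in lebesgue. z \<notin> {z \<in> \<Omega>. f z \<noteq> 0}"
    by eventually_elim (auto simp: indicator_def split: if_splits)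
  then have "negligible {z \<in> \<Omega>. f z \<noteq> 0}"
    using AE_iff_null_sets[of "{z \<in> \<Omega>. f z \<noteq> 0}" lebesgue] by (auto simp: negligible_iff_null_sets)
  moreover have "open {z \<in> \<Omega>. f z \<noteq> 0}"
  proof -
    have "open (f -` (- {0}) \<inter> \<Omega>)"
      using f \<Omega> holo_on_imp_continuous_on
      by (intro continuous_on_open_vimage[THEN iffD1, rule_format]) (auto simp: OLp_below_def)
    also have "f -` (- {0}) \<inter> \<Omega> = {z \<in> \<Omega>. f z \<noteq> 0}"
      by auto
    finally show ?thesis .
  qed
  ultimately have "{z \<in> \<Omega>. f z \<noteq> 0} = {}"
    using open_not_negligible by blast
  then show ?thesis
    using f by (auto simp: OLp_below_def fun_eq_iff)
qed

lemma summable_half_powers_ratio: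
  fixes a :: "nat \<Rightarrow> real"
  assumes "\<And>j. a j \<ge> 0"
  shows "summable (\<lambda>j. (1/2) ^ Suc j * (a j / (1 + a j)))"
proof (rule summable_comparison_test'[of "\<lambda>j. (1/2) ^ j" 0])
  fix j
  have "(1/2::real) ^ Suc j * (a j / (1 + a j)) \<le> (1/2) ^ j * 1"
    using assms[of j] by (intro mult_mono) auto
  then show "norm ((1/2) ^ Suc j * (a j / (1 + a j))) \<le> (1/2) ^ j"
    using assms[of j] by (simp add: abs_mult)
qed auto

lemma ratio_mono:
  fixes s t :: real
  assumes "0 \<le> s" "s \<le> t"
  shows "s / (1 + s) \<le> t / (1 + t)"
  using assms by (simp add: field_simps)

lemma ratio_subadditive:
  fixes s t u :: real
  assumes "0 \<le> s" "0 \<le> t" "0 \<le> u" "u \<le> s + t"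
  shows "u / (1 + u) \<le> s / (1 + s) + t / (1 + t)"
proof -
  have "u / (1 + u) \<le> (s + t) / (1 + (s + t))"
    using assms by (intro ratio_mono) auto
  also have "\<dots> = s / (1 + (s + t)) + t / (1 + (s + t))"
    by (simp add: add_divide_distrib)
  also have "\<dots> \<le> s / (1 + s) + t / (1 + t)"
    using assms by (intro add_mono divide_left_mono) auto
  finally show ?thesis .
qed

lemma exponent_less:
  assumes "strict_mono ps" "(\<lambda>j. ereal (ps j)) \<longlonglongrightarrow> q"
  shows "ereal (ps j) < q"
proof -
  have "ereal (ps j) < ereal (ps (Suc j))"
    using assms(1) by (simp add: strict_mono_def)
  also have "incseq (\<lambda>j. ereal (ps j))"
    using assms(1) by (auto simp: incseq_def strict_mono_less_eq)
  then have "ereal (ps (Suc j)) \<le> q"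
    using incseq_le assms(2) by blast
  finally show ?thesis .
qed

lemma exponent_gt_1:
  assumes "strict_mono (ps :: nat \<Rightarrow> real)" "1 < ps 0"
  shows "1 < ps j"
  using assms by (meson le0 less_le_trans strict_mono_less_eq)

lemma Metric_space_OLp_below:
  fixes \<Omega> :: "(complex ^ 'n::finite) set"
  assumes \<Omega>: "open \<Omega>" and ps: "1 < ps 0" "strict_mono ps" "(\<lambda>j. ereal (ps j)) \<longlonglongrightarrow> q"
  shows "Metric_space (OLp_below q \<Omega>) (OLp_dist ps \<Omega>)"
proof
  note sm = summable_half_powers_ratio[of "\<lambda>j. lp_norm (ps j) \<Omega> _", OF lp_norm_nonneg]
  note p1 = exponent_gt_1[OF ps(2) ps(1)] and pq = exponent_less[OF ps(2) ps(3)]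
  fix f g h :: "complex ^ 'n \<Rightarrow> complex"
  show "0 \<le> OLp_dist ps \<Omega> f g"
    unfolding OLp_dist_def by (intro suminf_nonneg sm) auto
  show "OLp_dist ps \<Omega> f g = OLp_dist ps \<Omega> g f"
    unfolding OLp_dist_def lp_norm_diff_commute[of _ \<Omega> f g] ..
  assume f: "f \<in> OLp_below q \<Omega>" and g: "g \<in> OLp_below q \<Omega>"
  show "OLp_dist ps \<Omega> f g = 0 \<longleftrightarrow> f = g"
  proof
    assume "OLp_dist ps \<Omega> f g = 0"
    then have "(1/2) ^ Suc 0 * (lp_norm (ps 0) \<Omega> (\<lambda>z. f z - g z) / (1 + lp_norm (ps 0) \<Omega> (\<lambda>z. f z - g z))) = 0"
      unfolding OLp_dist_def by (subst (asm) suminf_eq_zero_iff[OF sm]) (auto simp del: power_Suc)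
    moreover have "1 + lp_norm (ps 0) \<Omega> (\<lambda>z. f z - g z) > 0"
      by (simp add: add_pos_nonneg)
    ultimately have "lp_norm (ps 0) \<Omega> (\<lambda>z. f z - g z) = 0"
      by auto
    then have "(\<lambda>z. f z - g z) = (\<lambda>z. 0)"
      using lp_norm_eq_0_imp_eq_0[OF OLp_below_diff[OF f g \<Omega>] \<Omega> _ pq[of 0]] p1[of 0] by simp
    then show "f = g"
      by (auto simp: fun_eq_iff)
  next
    assume "f = g"
    then show "OLp_dist ps \<Omega> f g = 0"
      by (simp add: OLp_dist_def lp_norm_def lp_int_def)
  qed
  assume h: "h \<in> OLp_below q \<Omega>"
  have "lp_norm (ps j) \<Omega> (\<lambda>z. f z - h z) \<le> lp_norm (ps j) \<Omega> (\<lambda>z. f z - g z) + lp_norm (ps j) \<Omega> (\<lambda>z. g z - h z)" for j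
  proof -
    have fg: "(\<lambda>z. f z - g z) \<in> OLp_below q \<Omega>" and gh: "(\<lambda>z. g z - h z) \<in> OLp_below q \<Omega>"
      using f g h \<Omega> OLp_below_diff by blast+
    show ?thesis
      using lp_norm_triangle[OF _ OLp_below_borel_measurable[OF fg \<Omega>] OLp_below_borel_measurable[OF gh \<Omega>], of "ps j" \<Omega>]
        fg gh p1[of j] pq[of j] \<Omega> by (auto simp: OLp_below_def)
  qed
  then have "(1/2) ^ Suc j * (lp_norm (ps j) \<Omega> (\<lambda>z. f z - h z) / (1 + lp_norm (ps j) \<Omega> (\<lambda>z. f z - h z)))
      \<le> (1/2) ^ Suc j * (lp_norm (ps j) \<Omega> (\<lambda>z. f z - g z) / (1 + lp_norm (ps j) \<Omega> (\<lambda>z. f z - g z)))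
      + (1/2) ^ Suc j * (lp_norm (ps j) \<Omega> (\<lambda>z. g z - h z) / (1 + lp_norm (ps j) \<Omega> (\<lambda>z. g z - h z)))" for j
    unfolding distrib_left[symmetric] by (intro mult_left_mono ratio_subadditive) auto
  then show "OLp_dist ps \<Omega> f h \<le> OLp_dist ps \<Omega> f g + OLp_dist ps \<Omega> g h"
    unfolding OLp_dist_def suminf_add[OF sm sm] by (intro suminf_le summable_add sm)
qed

section \<open>A holomorphic function with logarithmic singularities\<close>

definition herm :: "complex ^ 'n::finite \<Rightarrow> complex ^ 'n \<Rightarrow> complex" where
  "herm a v = (\<Sum>i\<in>UNIV. cnj (a $ i) * v $ i)"

lemma Re_herm: "Re (herm a v) = a \<bullet> v"
  by (simp add: herm_def inner_vec_def inner_complex_def)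

lemma herm_scale: "herm a (c *s v) = c * herm a v"
  by (simp add: herm_def sum_distrib_left algebra_simps)

lemma herm_minus: "herm a (- v) = - herm a v"
  by (simp add: herm_def sum_negf)

lemma norm_herm_le: "norm (herm a v) \<le> real CARD('n) * norm a * norm v"
  for a v :: "complex ^ 'n::finite"
proof -
  have "norm (herm a v) \<le> (\<Sum>i\<in>(UNIV::'n set). norm a * norm v)"
    unfolding herm_def
    by (intro sum_norm_le) (auto simp: norm_mult intro!: mult_mono Finite_Cartesian_Product.norm_nth_le)
  then show ?thesis
    by simp
qed

lemma bounded_linear_herm: "bounded_linear (herm a)"
  unfolding herm_def
  by (intro bounded_linear_sum bounded_linear_const_mult bounded_linear_vec_nth)

lemma supporting_unit_normal:
  fixes \<Omega> :: "'a::euclidean_space set"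
  assumes "open \<Omega>" "convex \<Omega>" "w \<in> frontier \<Omega>"
  obtains a where "norm a = 1" "\<And>z r. r > 0 \<Longrightarrow> ball z r \<subseteq> \<Omega> \<Longrightarrow> r \<le> a \<bullet> (w - z)"
proof -
  have "w \<in> closure \<Omega>" "w \<notin> rel_interior \<Omega>"
    using assms by (auto simp: frontier_def rel_interior_open interior_open)
  then obtain b where b: "b \<noteq> 0" "\<And>y. y \<in> closure \<Omega> \<Longrightarrow> b \<bullet> w \<le> b \<bullet> y"
    using supporting_hyperplane_relative_frontier[OF assms(2)] by metis
  define a where "a = - (b /\<^sub>R norm b)"
  have "r \<le> a \<bullet> (w - z)" if "r > 0" "ball z r \<subseteq> \<Omega>" for z r
  proof -
    have "z + r *\<^sub>R a \<in> cball z r"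
      using that b by (simp add: dist_norm a_def)
    then have "z + r *\<^sub>R a \<in> closure \<Omega>"
      using closure_mono[OF that(2)] that(1) by auto
    then have "b \<bullet> w \<le> b \<bullet> z + r * (b \<bullet> a)"
      using b(2)[of "z + r *\<^sub>R a"] by (simp add: inner_add_right)
    also have "b \<bullet> a = - norm b"
      using b(1) by (simp add: a_def dot_square_norm power2_eq_square)
    finally have "r * norm b \<le> b \<bullet> z - b \<bullet> w"
      by simp
    then have "r \<le> (b \<bullet> z - b \<bullet> w) / norm b"
      using b(1) by (simp add: pos_le_divide_eq)
    then show ?thesis
      by (simp add: a_def inner_diff_right divide_inverse algebra_simps)
  qed
  moreover have "norm a = 1"
    using b(1) by (simp add: a_def)
  ultimately show ?thesis
    using that by blast
qed

lemma suminf_half_powers_bound: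
  fixes f :: "nat \<Rightarrow> complex"
  assumes "\<And>j. norm (f j) \<le> (1/2) ^ Suc j * K"
  shows "summable f" "norm (suminf f) \<le> K"
proof -
  have *: "(\<lambda>j. (1/2) ^ Suc j * K) sums K"
    using sums_mult2[OF power_half_series, of K] by simp
  show "summable f"
    using assms sums_summable[OF *] by (rule summable_comparison_test'[of _ 0, rotated])
  have "summable (\<lambda>j. norm (f j))"
    using assms by (intro summable_comparison_test'[OF sums_summable[OF *], of 0]) (auto simp del: power_Suc)
  then show "norm (suminf f) \<le> K"
    using summable_norm[of f] suminf_le[OF assms _ sums_summable[OF *]] sums_unique[OF *] by simp
qed

lemma exists_unbounded_log_bounded:
  fixes \<Omega> :: "(complex ^ 'n::finite) set"
  assumes \<Omega>: "bounded \<Omega>" "open \<Omega>" "convex \<Omega>" "\<Omega> \<noteq> {}"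
  obtains h C where "holo_on \<Omega> h" "\<And>z. z \<notin> \<Omega> \<Longrightarrow> h z = 0" "C > 0"
    "\<And>z r. r > 0 \<Longrightarrow> ball z r \<subseteq> \<Omega> \<Longrightarrow> norm (h z) \<le> ln (C / r) + pi"
    "\<And>w \<delta>. w \<in> frontier \<Omega> \<Longrightarrow> \<delta> > 0 \<Longrightarrow> \<not> bounded (h ` (ball w \<delta> \<inter> \<Omega>))"
proof -
  define N where "N = real CARD('n)"
  have N: "N > 0"
    by (simp add: N_def)
  obtain D where D: "countable D" "D \<subseteq> frontier \<Omega>" "frontier \<Omega> \<subseteq> closure D"
    using separable by blast
  have "frontier \<Omega> \<noteq> {}"
    using \<Omega> not_bounded_UNIV by (auto simp: frontier_eq_empty)
  with D have "D \<noteq> {}"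
    by auto
  define w where "w = from_nat_into D"
  have w: "range w = D" "w j \<in> frontier \<Omega>" for j
    using D \<open>D \<noteq> {}\<close> from_nat_into[of D j] by (auto simp: w_def)
  have "\<exists>a. norm a = 1 \<and> (\<forall>z r. r > 0 \<longrightarrow> ball z r \<subseteq> \<Omega> \<longrightarrow> r \<le> a \<bullet> (w j - z))" for j
    using supporting_unit_normal[OF \<Omega>(2,3) w(2)] by metis
  then obtain a where a: "\<And>j. norm (a j) = 1"
      "\<And>j z r. r > 0 \<Longrightarrow> ball z r \<subseteq> \<Omega> \<Longrightarrow> r \<le> a j \<bullet> (w j - z)"
    by metis
  define l where "l j z = herm (a j) (w j - z)" for j z
  have l_le: "norm (l j z) \<le> N * norm (w j - z)" for j z
    using norm_herm_le[of "a j" "w j - z"] by (simp add: l_def a N_def)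
  obtain B where B: "B > 0" "\<And>z. z \<in> closure \<Omega> \<Longrightarrow> norm z \<le> B"
    using bounded_closure[OF \<Omega>(1)] unfolding bounded_pos by auto
  define C where "C = N * (2 * B)"
  have C: "C > 0"
    using N B by (simp add: C_def)
  have l_C: "norm (l j z) \<le> C" if "z \<in> \<Omega>" for j z
  proof -
    have "norm (w j - z) \<le> B + B"
      using B(2)[of z] B(2)[of "w j"] w(2)[of j] that closure_subset[of \<Omega>]
      by (intro order_trans[OF norm_triangle_ineq4] add_mono) (auto simp: frontier_def)
    then have "N * norm (w j - z) \<le> C"
      unfolding C_def using N by (intro mult_left_mono) auto
    with l_le[of j z] show ?thesis
      by linarith
  qed
  have Re_l: "r \<le> Re (l j z)" and l_ge: "r \<le> norm (l j z)" if "r > 0" "ball z r \<subseteq> \<Omega>" for r j z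
    using a(2)[OF that, of j] complex_Re_le_cmod[of "l j z"] by (simp_all add: l_def Re_herm)
  have l_pos: "Re (l j z) > 0" if "z \<in> \<Omega>" for j z
    using \<Omega>(2) that Re_l unfolding open_contains_ball by (meson less_le_trans)
  define H where "H j z = of_real (ln C) - Ln (l j z)" for j z
  have Re_H: "Re (H j z) = ln C - ln (norm (l j z))" if "z \<in> \<Omega>" for j z
  proof -
    have "l j z \<noteq> 0"
      using l_pos[OF that, of j] by auto
    then show ?thesis
      by (simp add: H_def)
  qed
  have Re_H_nonneg: "Re (H j z) \<ge> 0" if "z \<in> \<Omega>" for j z
  proof -
    have "l j z \<noteq> 0"
      using l_pos[OF that, of j] by auto
    then show ?thesis
      using l_C[OF that, of j] C by (simp add: Re_H[OF that])
  qed
  have norm_H: "norm (H j z) \<le> ln (C / r) + pi" if r: "r > 0" "ball z r \<subseteq> \<Omega>" for j z r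
  proof -
    have z: "z \<in> \<Omega>"
      using r by auto
    have "ln r \<le> ln (norm (l j z))"
      using l_ge[OF r, of j] r(1) by (subst ln_le_cancel_iff) auto
    then have "\<bar>Re (H j z)\<bar> \<le> ln (C / r)"
      using Re_H_nonneg[OF z, of j] C r(1) by (simp add: Re_H[OF z] ln_div)
    moreover have "\<bar>Im (H j z)\<bar> \<le> pi"
      using Re_Ln_pos_lt_imp[OF l_pos[OF z, of j]] pi_gt_zero by (simp add: H_def)
    ultimately show ?thesis
      using cmod_le[of "H j z"] by linarith
  qed
  define T where "T j z = of_real ((1/2) ^ Suc j) * H j z" for j z
  define h where "h z = (if z \<in> \<Omega> then \<Sum>j. T j z else 0)" for z
  have norm_T: "norm (T j z) \<le> (1/2) ^ Suc j * (ln (C / r) + pi)" if "r > 0" "ball z r \<subseteq> \<Omega>" for j z r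
    unfolding T_def norm_mult norm_of_real using norm_H[OF that, of j] by (intro mult_mono) auto
  have summ: "summable (\<lambda>j. T j z)" if z: "z \<in> \<Omega>" for z
  proof -
    obtain r where r: "r > 0" "ball z r \<subseteq> \<Omega>"
      using \<Omega>(2) z unfolding open_contains_ball by blast
    show ?thesis
      by (rule suminf_half_powers_bound(1)[OF norm_T[OF r]])
  qed
  have norm_h: "norm (h z) \<le> ln (C / r) + pi" if "r > 0" "ball z r \<subseteq> \<Omega>" for z r
    using suminf_half_powers_bound(2)[OF norm_T[OF that]] subsetD[OF that(2), of z] that(1)
    by (simp add: h_def)
  have Re_h: "(1/2) ^ Suc j * Re (H j z) \<le> Re (h z)" if z: "z \<in> \<Omega>" for j z
  proof -
    have "(\<lambda>j. Re (T j z)) sums Re (h z)"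
      using summable_sums[OF summ[OF z]] z by (simp add: h_def sums_Re)
    moreover have "Re (T i z) \<ge> 0" for i
      unfolding T_def Re_complex_of_real times_complex.sel using Re_H_nonneg[OF z] by simp
    ultimately have "Re (T j z) \<le> Re (h z)"
      using sum_le_suminf[of "\<lambda>j. Re (T j z)" "{j}"] sums_unique sums_summable by fastforce
    then show ?thesis
      unfolding T_def Re_complex_of_real times_complex.sel by simp
  qed
  define G where "G j z v = of_real ((1/2) ^ Suc j) * (herm (a j) v / l j z)" for j z v
  have norm_G: "norm (G j z v) \<le> (1/2) ^ Suc j * (N / r * norm v)" if "r > 0" "ball z r \<subseteq> \<Omega>" for j z v r
  proof -
    have "norm (herm (a j) v) / norm (l j z) \<le> (N * norm v) / r"
      using norm_herm_le[of "a j" v] l_ge[OF that, of j] that(1) N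
      by (intro frac_le) (auto simp: a N_def)
    then show ?thesis
      unfolding G_def norm_mult norm_of_real norm_divide by (intro mult_mono) auto
  qed
  have T_deriv: "(T j has_derivative G j z) (at z)" if z: "z \<in> \<Omega>" for j z
  proof -
    have "l j z \<notin> \<real>\<^sub>\<le>\<^sub>0"
      using l_pos[OF z, of j] by (auto simp: complex_nonpos_Reals_iff)
    then have dLn: "(Ln has_derivative (\<lambda>y. inverse (l j z) * y)) (at (l j z))"
      using has_field_derivative_Ln has_field_derivative_def by blast
    have dl: "(l j has_derivative (\<lambda>v. herm (a j) (- v))) (at z)"
      unfolding l_def
      by (rule bounded_linear.has_derivative[OF bounded_linear_herm]) (auto intro!: derivative_eq_intros)
    have "((\<lambda>z. Ln (l j z)) has_derivative (\<lambda>v. inverse (l j z) * herm (a j) (- v))) (at z)"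
      by (rule has_derivative_compose[OF dl dLn])
    then have "((\<lambda>z. of_real ((1/2) ^ Suc j) * (of_real (ln C) - Ln (l j z))) has_derivative
        (\<lambda>v. of_real ((1/2) ^ Suc j) * (0 - inverse (l j z) * herm (a j) (- v)))) (at z)"
      by (intro has_derivative_mult_right has_derivative_diff has_derivative_const)
    moreover have "(\<lambda>z. of_real ((1/2) ^ Suc j) * (of_real (ln C) - Ln (l j z))) = T j"
      by (simp add: fun_eq_iff T_def H_def)
    moreover have "(\<lambda>v. of_real ((1/2) ^ Suc j) * (0 - inverse (l j z) * herm (a j) (- v))) = G j z"
    proof -
      have "e * (0 - inverse x * (- y)) = e * (y / x)" for e x y :: complex
        by (simp add: divide_inverse)
      then show ?thesis
        by (intro ext) (simp only: G_def herm_minus)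
    qed
    ultimately show ?thesis
      by (simp only:)
  qed
  have "holo_on \<Omega> h"
    unfolding holo_on_def
  proof
    fix z0 assume "z0 \<in> \<Omega>"
    then obtain r where r: "r > 0" "ball z0 r \<subseteq> \<Omega>"
      using \<Omega>(2) unfolding open_contains_ball by blast
    define S where "S = ball z0 (r/2)"
    have S: "z0 \<in> S" "open S" "convex S" "S \<subseteq> \<Omega>"
      using r by (auto simp: S_def)
    have bS: "ball x (r/2) \<subseteq> \<Omega>" if "x \<in> S" for x
    proof -
      have "ball x (r/2) \<subseteq> ball z0 r"
        using that by (intro ball_subset_ball_iff[THEN iffD2]) (simp add: S_def dist_commute)
      with r show ?thesis by auto
    qed
    define G' where "G' x v = (\<Sum>j. G j x v)" for x v
    define K where "K = N / (r/2)"
    have GS: "norm (G j x v) \<le> (1/2) ^ Suc j * (K * norm v)" if "x \<in> S" for j x v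
      using norm_G[OF _ bS[OF that]] r by (simp add: K_def)
    have tail: "norm ((\<Sum>i<n. G i x v) - G' x v) \<le> (1/2) ^ n * K * norm v" if "x \<in> S" for n x v
    proof -
      have "G' x v = (\<Sum>i. G (i + n) x v) + (\<Sum>i<n. G i x v)"
        unfolding G'_def using suminf_half_powers_bound(1)[OF GS[OF that]]
        by (intro suminf_split_initial_segment)
      moreover have "norm (\<Sum>i. G (i + n) x v) \<le> (1/2) ^ n * (K * norm v)"
      proof (rule suminf_half_powers_bound(2))
        show "norm (G (i + n) x v) \<le> (1/2) ^ Suc i * ((1/2) ^ n * (K * norm v))" for i
          using GS[OF that, of "i + n" v] by (simp add: power_add mult.assoc)
      qed
      ultimately show ?thesis
        by (simp add: norm_minus_commute mult.assoc)
    qed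
    have "\<exists>g. \<forall>x\<in>S. (\<lambda>n. T n x) sums g x \<and> (g has_derivative G' x) (at x within S)"
    proof (rule has_derivative_series[OF S(3) _ _ S(1)])
      show "(T n has_derivative G n x) (at x within S)" if "x \<in> S" for n x
        using T_deriv that S by (blast intro: has_derivative_at_withinI)
      show "(\<lambda>n. T n z0) sums (\<Sum>n. T n z0)"
        using summ \<open>z0 \<in> \<Omega>\<close> by blast
      fix e :: real assume "e > 0"
      have "(\<lambda>n. (1/2) ^ n * K) \<longlonglongrightarrow> 0"
        by (intro tendsto_mult_left_zero LIMSEQ_realpow_zero) auto
      then have "\<forall>\<^sub>F n in sequentially. (1/2) ^ n * K < e"
        using \<open>e > 0\<close> by (rule order_tendstoD)
      then show "\<forall>\<^sub>F n in sequentially. \<forall>x\<in>S. \<forall>v. norm ((\<Sum>i<n. G i x v) - G' x v) \<le> e * norm v"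
      proof eventually_elim
        case (elim n)
        then have "(1/2) ^ n * K * norm v \<le> e * norm v" for v :: "complex ^ 'n"
          by (intro mult_right_mono) auto
        then show ?case
          by (intro ballI allI order_trans[OF tail])
      qed
    qed
    then obtain g where g: "\<And>x. x \<in> S \<Longrightarrow> (\<lambda>n. T n x) sums g x"
        "(g has_derivative G' z0) (at z0 within S)"
      using S(1) by blast
    have gh: "g x = h x" if "x \<in> S" for x
      using sums_unique[OF g(1)[OF that]] that S by (auto simp: h_def)
    have "(g has_derivative G' z0) (at z0)"
      using g(2) by (simp only: at_within_open[OF S(1,2)])
    then have "(h has_derivative G' z0) (at z0)"
      using S(2,1) gh by (rule has_derivative_transform_within_open)
    moreover have "G' z0 (c *s v) = c * G' z0 v" for c v
    proof -
      have "G j z0 (c *s v) = c * G j z0 v" for j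
        by (simp add: G_def herm_scale)
      then show ?thesis
        unfolding G'_def using suminf_half_powers_bound(1)[OF GS[OF S(1)]]
        by (simp add: suminf_mult)
    qed
    ultimately show "\<exists>L. (h has_derivative L) (at z0) \<and> (\<forall>c v. L (c *s v) = c * L v)"
      by blast
  qed
  moreover have "\<not> bounded (h ` (ball u \<delta> \<inter> \<Omega>))" if u: "u \<in> frontier \<Omega>" "\<delta> > 0" for u \<delta>
  proof
    assume "bounded (h ` (ball u \<delta> \<inter> \<Omega>))"
    then obtain M where M: "\<And>z. z \<in> ball u \<delta> \<Longrightarrow> z \<in> \<Omega> \<Longrightarrow> norm (h z) \<le> M"
      unfolding bounded_iff by blast
    have "u \<in> closure D"
      using D u by auto
    then obtain j where j: "dist (w j) u < \<delta> / 2"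
      using u(2) w(1) closure_approachable[of u D] by (metis half_gt_zero rangeE)
    define m where "m = C * exp (- (M * 2 ^ Suc j))"
    have "m > 0"
      using C by (simp add: m_def)
    have "w j \<in> closure \<Omega>"
      using w(2)[of j] by (simp add: frontier_def)
    moreover have "min (\<delta> / 2) (m / N) > 0"
      using u(2) \<open>m > 0\<close> N by simp
    ultimately obtain z where z: "z \<in> \<Omega>" "dist z (w j) < min (\<delta> / 2) (m / N)"
      unfolding closure_approachable by blast
    have "dist z u < \<delta>"
      using z(2) j dist_triangle[of z u "w j"] by simp
    then have "norm (h z) \<le> M"
      using M z(1) by (simp add: dist_commute)
    then have "(1/2) ^ Suc j * Re (H j z) \<le> M"
      using Re_h[OF z(1), of j] complex_Re_le_cmod[of "h z"] by linarith
    then have "Re (H j z) \<le> M * 2 ^ Suc j"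
      by (simp add: power_divide field_simps)
    then have "ln m \<le> ln (norm (l j z))"
      using C by (simp add: Re_H[OF z(1)] m_def ln_mult)
    moreover have "l j z \<noteq> 0"
      using l_pos[OF z(1), of j] by auto
    ultimately have "m \<le> norm (l j z)"
      using \<open>m > 0\<close> by simp
    also have "\<dots> \<le> N * dist z (w j)"
      using l_le[of j z] by (simp add: dist_norm norm_minus_commute)
    also have "\<dots> < m"
      using z(2) N by (simp add: field_simps)
    finally show False
      by simp
  qed
  moreover have "h z = 0" if "z \<notin> \<Omega>" for z
    using that by (simp add: h_def)
  ultimately show ?thesis
    using that C norm_h by blast
qed

lemma ball_homothety_subset:
  fixes \<Omega> :: "'a::real_normed_vector set"
  assumes "convex \<Omega>" "ball z0 d \<subseteq> \<Omega>" "y \<in> \<Omega>" "0 \<le> s" "s < 1"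
  shows "ball ((1 - s) *\<^sub>R z0 + s *\<^sub>R y) ((1 - s) * d) \<subseteq> \<Omega>"
proof
  fix x assume x: "x \<in> ball ((1 - s) *\<^sub>R z0 + s *\<^sub>R y) ((1 - s) * d)"
  define u where "u = (1 / (1 - s)) *\<^sub>R (x - s *\<^sub>R y)"
  have xu: "x = (1 - s) *\<^sub>R u + s *\<^sub>R y"
    using assms by (simp add: u_def)
  have "dist ((1 - s) *\<^sub>R z0 + s *\<^sub>R y) x = (1 - s) * dist z0 u"
    using assms by (simp add: xu dist_norm flip: scaleR_diff_right)
  with x assms have "u \<in> ball z0 d"
    by simp
  with assms show "x \<in> \<Omega>"
    unfolding xu by (intro convexD) auto
qed

lemma measure_homothety_layer:
  fixes \<Omega> :: "'a::euclidean_space set"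
  assumes \<Omega>: "bounded \<Omega>" "open \<Omega>" and s: "0 < s" "s < 1"
    and sub: "(\<lambda>y. (1 - s) *\<^sub>R z0 + s *\<^sub>R y) ` \<Omega> \<subseteq> \<Omega>"
  shows "emeasure lebesgue (\<Omega> - (\<lambda>y. (1 - s) *\<^sub>R z0 + s *\<^sub>R y) ` \<Omega>)
    \<le> ennreal (real DIM('a) * (1 - s) * measure lebesgue \<Omega>)"
proof -
  let ?A = "(\<lambda>y. (1 - s) *\<^sub>R z0 + s *\<^sub>R y) ` \<Omega>"
  have A: "open ?A" "bounded ?A"
    using \<Omega> s bounded_subset[OF _ sub] by (auto intro: open_affinity)
  have lm: "\<Omega> \<in> lmeasurable" "?A \<in> lmeasurable"
    using \<Omega> A by (auto intro: lmeasurable_open)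
  have "measure lebesgue (\<Omega> - ?A) = measure lebesgue \<Omega> - measure lebesgue ?A"
    using lm sub by (intro measurable_measure_Diff) (auto dest: fmeasurableD)
  also have "measure lebesgue ?A = s ^ DIM('a) * measure lebesgue \<Omega>"
    using measure_lebesgue_affine[of s "(1 - s) *\<^sub>R z0" \<Omega>] s by (simp add: add.commute)
  also have "measure lebesgue \<Omega> - s ^ DIM('a) * measure lebesgue \<Omega> = (1 - s ^ DIM('a)) * measure lebesgue \<Omega>"
    by (simp add: algebra_simps)
  also have "\<dots> \<le> (real DIM('a) * (1 - s)) * measure lebesgue \<Omega>"
    using Bernoulli_inequality[of "s - 1" "DIM('a)"] s by (intro mult_right_mono) (auto simp: algebra_simps)
  finally have "measure lebesgue (\<Omega> - ?A) \<le> real DIM('a) * (1 - s) * measure lebesgue \<Omega>" .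
  moreover have "emeasure lebesgue (\<Omega> - ?A) = measure lebesgue (\<Omega> - ?A)"
    using lm by (intro emeasure_eq_measure2 fmeasurable.Diff)
  ultimately show ?thesis
    by (simp add: ennreal_leI)
qed

lemma log_bounded_imp_lp_int_finite:
  fixes \<Omega> :: "(complex ^ 'n::finite) set"
  assumes \<Omega>: "bounded \<Omega>" "open \<Omega>" "convex \<Omega>" "\<Omega> \<noteq> {}" and C: "C > 0" and p: "p \<ge> 1"
    and h: "\<And>z r. r > 0 \<Longrightarrow> ball z r \<subseteq> \<Omega> \<Longrightarrow> norm (h z) \<le> ln (C / r) + pi"
  shows "lp_int p \<Omega> h < \<infinity>"
proof -
  obtain z0 d where z0: "z0 \<in> \<Omega>" "d > 0" "ball z0 d \<subseteq> \<Omega>"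
    using \<Omega> unfolding open_contains_ball by blast
  define s :: "nat \<Rightarrow> real" where "s k = 1 - (1/2) ^ Suc k" for k
  have s: "0 < s k" "s k < 1" for k
    using power_Suc_less_one[of "1/2::real" k] by (auto simp: s_def)
  define A where "A k = (\<lambda>y. (1 - s k) *\<^sub>R z0 + s k *\<^sub>R y) ` \<Omega>" for k
  have A_ball: "ball z ((1/2) ^ Suc k * d) \<subseteq> \<Omega>" if "z \<in> A k" for z k
    using that ball_homothety_subset[OF \<Omega>(3) z0(3), of _ "s k"] s[of k]
    by (auto simp: A_def s_def simp del: power_Suc)
  have A_sub: "A k \<subseteq> \<Omega>" for k
  proof
    fix z assume "z \<in> A k"
    then show "z \<in> \<Omega>"
      using subsetD[OF A_ball, of z k z] z0(2) by simp
  qed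
  have A_cover: "\<exists>k. z \<in> A k" if "z \<in> \<Omega>" for z
  proof -
    have "s \<longlonglongrightarrow> 1 - 0"
      unfolding s_def by (intro tendsto_intros LIMSEQ_Suc LIMSEQ_realpow_zero) auto
    then have "(\<lambda>k. z0 + (1 / s k) *\<^sub>R (z - z0)) \<longlonglongrightarrow> z0 + (1 / (1 - 0)) *\<^sub>R (z - z0)"
      by (intro tendsto_intros) auto
    then have "\<forall>\<^sub>F k in sequentially. z0 + (1 / s k) *\<^sub>R (z - z0) \<in> \<Omega>"
      using \<Omega>(2) that by (intro topological_tendstoD) auto
    then obtain k where "z0 + (1 / s k) *\<^sub>R (z - z0) \<in> \<Omega>"
      using eventually_happens trivial_limit_sequentially by blast
    moreover have "z = (1 - s k) *\<^sub>R z0 + s k *\<^sub>R (z0 + (1 / s k) *\<^sub>R (z - z0))"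
      using s(1)[of k] by (simp add: algebra_simps)
    ultimately show ?thesis
      unfolding A_def by blast
  qed
  define \<alpha> where "\<alpha> = \<bar>ln (C / d)\<bar> + pi"
  have \<alpha>: "\<alpha> > 0"
    by (simp add: \<alpha>_def add_nonneg_pos)
  define \<beta> where "\<beta> k = \<alpha> + real (Suc k) * ln 2" for k
  have hA: "norm (h z) powr p \<le> \<beta> k powr p" if "z \<in> A k" for z k
  proof -
    have "C / ((1/2) ^ Suc k * d) = (C / d) * 2 ^ Suc k"
      by (simp add: power_divide)
    then have "ln (C / ((1/2) ^ Suc k * d)) = ln (C / d) + real (Suc k) * ln 2"
      using C z0(2) by (simp only:) (simp add: ln_mult_pos ln_realpow del: power_Suc times_divide_eq_left)
    moreover have "norm (h z) \<le> ln (C / ((1/2) ^ Suc k * d)) + pi"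
      using z0(2) by (intro h A_ball that) simp
    ultimately show ?thesis
      using p by (intro powr_mono2) (auto simp: \<beta>_def \<alpha>_def)
  qed
  let ?S = "\<lambda>z. \<Sum>k. ennreal (\<beta> (Suc k) powr p) * indicator (\<Omega> - A k) z"
  have pointwise: "ennreal (norm (h z) powr p) * indicator \<Omega> z \<le> ennreal (\<beta> 0 powr p) * indicator \<Omega> z + ?S z" for z
  proof (cases "z \<in> \<Omega>")
    case True
    define k where "k = (LEAST k. z \<in> A k)"
    have k: "z \<in> A k"
      unfolding k_def using A_cover[OF True] by (rule LeastI_ex)
    show ?thesis
    proof (cases k)
      case 0
      then show ?thesis
        using hA[OF k] True by (auto intro!: add_increasing2 ennreal_leI)
    next
      case (Suc i)
      then have "z \<notin> A i"
        using not_less_Least[of i "\<lambda>k. z \<in> A k"] by (simp add: k_def)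
      then have "ennreal (norm (h z) powr p) * indicator \<Omega> z \<le> ennreal (\<beta> (Suc i) powr p) * indicator (\<Omega> - A i) z"
        using hA[OF k] True Suc by (auto intro!: ennreal_leI)
      also have "\<dots> \<le> ?S z"
        using sum_le_suminf[of "\<lambda>k. ennreal (\<beta> (Suc k) powr p) * indicator (\<Omega> - A k) z" "{i}"]
        by (simp del: sum_mult_indicator)
      finally show ?thesis
        by (simp add: add_increasing)
    qed
  qed simp
  have meas [measurable]: "\<Omega> \<in> sets lebesgue" "A k \<in> sets lebesgue" for k
    using \<Omega>(2) open_affinity[OF \<Omega>(2), of "s k" "(1 - s k) *\<^sub>R z0"] s(1)[of k] by (auto simp: A_def)
  define m where "m = real DIM(complex ^ 'n) * measure lebesgue \<Omega>"
  have layer: "emeasure lebesgue (\<Omega> - A k) \<le> ennreal (m * (1/2) ^ Suc k)" for k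
    using measure_homothety_layer[OF \<Omega>(1,2) s A_sub[unfolded A_def]]
    by (simp add: A_def s_def m_def mult_ac)
  have summ: "summable (\<lambda>k. \<beta> (Suc k) powr p * (m * (1/2) ^ Suc k))"
  proof -
    have "(\<lambda>k. (\<alpha> + real (Suc (Suc k)) * ln 2) powr p * (1/2) ^ Suc k) \<in> O(\<lambda>k. (3/4) ^ k)"
      by real_asymp
    moreover have "summable (\<lambda>k. norm ((3/4::real) ^ k))"
      by simp
    ultimately have "summable (\<lambda>k. \<beta> (Suc k) powr p * (1/2) ^ Suc k)"
      unfolding \<beta>_def by (rule summable_comparison_test_bigo[rotated])
    then show ?thesis
      using summable_mult[of _ m] by (simp only: mult.left_commute)
  qed
  have "lp_int p \<Omega> h \<le> (\<integral>\<^sup>+z. ennreal (\<beta> 0 powr p) * indicator \<Omega> z + ?S z \<partial>lebesgue)"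
    unfolding lp_int_def by (intro nn_integral_mono pointwise)
  also have "\<dots> = ennreal (\<beta> 0 powr p) * emeasure lebesgue \<Omega>
      + (\<Sum>k. ennreal (\<beta> (Suc k) powr p) * emeasure lebesgue (\<Omega> - A k))"
    by (subst nn_integral_add) (auto simp: nn_integral_suminf nn_integral_cmult_indicator)
  also have "\<dots> \<le> ennreal (\<beta> 0 powr p) * emeasure lebesgue \<Omega>
      + (\<Sum>k. ennreal (\<beta> (Suc k) powr p * (m * (1/2) ^ Suc k)))"
    using layer by (intro add_mono suminf_le) (auto simp: ennreal_mult' intro!: mult_left_mono simp del: power_Suc)
  also have "\<dots> < \<infinity>"
  proof -
    have "(\<Sum>k. ennreal (\<beta> (Suc k) powr p * (m * (1/2) ^ Suc k))) \<noteq> top"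
      by (rule ennreal_suminf_neq_top[OF summ]) (simp add: m_def)
    moreover have "ennreal (\<beta> 0 powr p) * emeasure lebesgue \<Omega> < top"
      using emeasure_bounded_finite[OF \<Omega>(1)] \<Omega>(2) by (simp add: ennreal_mult_less_top)
    ultimately show ?thesis
      by (simp only: infinity_ennreal_def ennreal_add_eq_top less_top[symmetric] simp_thms)
  qed
  finally show ?thesis .
qed

section \<open>Density and the countable intersection\<close>

lemma OLp_dist_ge:
  assumes "0 \<le> t" "t \<le> lp_norm (ps 0) \<Omega> (\<lambda>z. f z - g z)"
  shows "(1/2) * (t / (1 + t)) \<le> OLp_dist ps \<Omega> f g"
proof -
  have "(1/2) * (t / (1 + t)) \<le> (1/2) ^ 1 * (lp_norm (ps 0) \<Omega> (\<lambda>z. f z - g z) / (1 + lp_norm (ps 0) \<Omega> (\<lambda>z. f z - g z)))"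
    unfolding power_one_right by (intro mult_left_mono ratio_mono assms) simp
  also have "\<dots> \<le> OLp_dist ps \<Omega> f g"
    unfolding OLp_dist_def
    using sum_le_suminf[OF summable_half_powers_ratio[of "\<lambda>j. lp_norm (ps j) \<Omega> (\<lambda>z. f z - g z)"], of "{0}"]
    by simp
  finally show ?thesis .
qed

text \<open>If \<open>|g| > m + c\<close> on a ball \<open>V\<close> in \<open>E\<close> and \<open>|g'| \<le> m\<close> on \<open>E\<close>, then \<open>|g - g'| \<ge> c\<close> on \<open>V\<close>,
  which bounds the distance from below.\<close>

lemma openin_exceeds:
  fixes \<Omega> :: "(complex ^ 'n::finite) set"
  assumes \<Omega>: "open \<Omega>" and ps: "1 < ps 0" "strict_mono ps" "(\<lambda>j. ereal (ps j)) \<longlonglongrightarrow> q"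
    and E: "open E" "E \<subseteq> \<Omega>"
  shows "openin (Metric_space.mtopology (OLp_below q \<Omega>) (OLp_dist ps \<Omega>))
    {g \<in> OLp_below q \<Omega>. \<exists>z\<in>E. m < norm (g z)}"
proof -
  interpret M: Metric_space "OLp_below q \<Omega>" "OLp_dist ps \<Omega>"
    by (rule Metric_space_OLp_below[OF \<Omega> ps])
  have "\<exists>r>0. M.mball g r \<subseteq> {g \<in> OLp_below q \<Omega>. \<exists>z\<in>E. m < norm (g z)}"
    if g: "g \<in> OLp_below q \<Omega>" and z: "z \<in> E" "m < norm (g z)" for g z
  proof -
    define p where "p = ps 0"
    have p: "1 < p" "ereal p < q"
      using ps exponent_less[of ps q 0] by (auto simp: p_def)
    define c where "c = (norm (g z) - m) / 2"
    have c: "c > 0" "m + c < norm (g z)"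
      using z by (auto simp: c_def field_simps)
    have "continuous_on E (\<lambda>x. norm (g x))"
      using g E holo_on_imp_continuous_on
      by (intro continuous_on_norm) (auto simp: OLp_below_def intro: continuous_on_subset)
    then have "open ((\<lambda>x. norm (g x)) -` {m + c<..} \<inter> E)"
      using E(1) by (intro continuous_on_open_vimage[THEN iffD1, rule_format]) auto
    moreover have "z \<in> (\<lambda>x. norm (g x)) -` {m + c<..} \<inter> E"
      using z c by auto
    ultimately obtain \<epsilon> where \<epsilon>: "\<epsilon> > 0" "ball z \<epsilon> \<subseteq> (\<lambda>x. norm (g x)) -` {m + c<..} \<inter> E"
      unfolding open_contains_ball by blast
    define V where "V = ball z \<epsilon>"
    define \<mu> where "\<mu> = measure lebesgue V"
    have V: "V \<subseteq> E" "\<And>x. x \<in> V \<Longrightarrow> m + c < norm (g x)" "emeasure lebesgue V = ennreal \<mu>" "\<mu> > 0"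
      using \<epsilon> content_ball_pos[of \<epsilon> z]
      by (auto simp: V_def \<mu>_def emeasure_eq_measure2[OF lmeasurable_ball])
    define \<rho> where "\<rho> = c * \<mu> powr (1 / p)"
    have \<rho>: "\<rho> > 0"
      using c V by (simp add: \<rho>_def)
    have "M.mball g ((1/2) * (\<rho> / (1 + \<rho>))) \<subseteq> {g \<in> OLp_below q \<Omega>. \<exists>z\<in>E. m < norm (g z)}"
    proof (rule subsetI, rule ccontr)
      fix g' assume g': "g' \<in> M.mball g ((1/2) * (\<rho> / (1 + \<rho>)))"
        and "g' \<notin> {g \<in> OLp_below q \<Omega>. \<exists>z\<in>E. m < norm (g z)}"
      then have small: "norm (g' x) \<le> m" if "x \<in> E" for x
        using that by force
      have gg: "(\<lambda>z. g z - g' z) \<in> OLp_below q \<Omega>"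
        using g' \<Omega> by (intro OLp_below_diff) auto
      have "c powr p \<le> norm (g x - g' x) powr p" if "x \<in> V" for x
        using V(1) V(2)[OF that] small[of x] that c(1) p norm_triangle_ineq2[of "g x" "g' x"]
        by (intro powr_mono2) auto
      then have "ennreal (c powr p) * indicator V x \<le> ennreal (norm (g x - g' x) powr p) * indicator \<Omega> x" for x
        using V(1) E(2) by (auto simp: indicator_def intro!: ennreal_leI)
      then have "(\<integral>\<^sup>+x. ennreal (c powr p) * indicator V x \<partial>lebesgue) \<le> lp_int p \<Omega> (\<lambda>z. g z - g' z)"
        unfolding lp_int_def by (intro nn_integral_mono)
      also have "(\<integral>\<^sup>+x. ennreal (c powr p) * indicator V x \<partial>lebesgue) = ennreal (c powr p * \<mu>)"
        using V(3,4) by (subst nn_integral_cmult_indicator) (auto simp: V_def ennreal_mult)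
      finally have "c powr p * \<mu> \<le> enn2real (lp_int p \<Omega> (\<lambda>z. g z - g' z))"
        using gg p V(4) enn2real_mono[of "ennreal (c powr p * \<mu>)"] by (auto simp: OLp_below_def)
      then have "(c powr p * \<mu>) powr (1 / p) \<le> lp_norm p \<Omega> (\<lambda>z. g z - g' z)"
        unfolding lp_norm_def using V(4) p by (intro powr_mono2) auto
      moreover have "(c powr p * \<mu>) powr (1 / p) = \<rho>"
        using c V(4) p by (simp add: \<rho>_def powr_mult powr_powr)
      ultimately have "(1/2) * (\<rho> / (1 + \<rho>)) \<le> OLp_dist ps \<Omega> g g'"
        using \<rho> by (intro OLp_dist_ge) (auto simp: p_def)
      with g' show False
        by simp
    qed
    moreover have "(1/2) * (\<rho> / (1 + \<rho>)) > 0"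
      using \<rho> by (simp add: add_pos_pos)
    ultimately show ?thesis
      by blast
  qed
  then show ?thesis
    unfolding M.openin_mtopology by blast
qed

lemma OLp_dist_perturbation_tendsto:
  fixes \<Omega> :: "(complex ^ 'n::finite) set"
  assumes \<Omega>: "open \<Omega>" and ps: "1 < ps 0" "strict_mono ps" and h: "h \<in> OLp_below q \<Omega>"
  shows "((\<lambda>c. OLp_dist ps \<Omega> f (\<lambda>z. f z + complex_of_real c * h z)) \<longlongrightarrow> 0) (at_right 0)"
proof -
  define a where "a j = lp_norm (ps j) \<Omega> h" for j
  define F where "F c j = (1/2) ^ Suc j * (\<bar>c\<bar> * a j / (1 + \<bar>c\<bar> * a j))" for c j
  have a: "a j \<ge> 0" for j
    by (simp add: a_def)
  have pos: "1 + \<bar>c\<bar> * a j > 0" for c j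
    using a[of j] by (simp add: add_pos_nonneg)
  have eq: "OLp_dist ps \<Omega> f (\<lambda>z. f z + complex_of_real c * h z) = (\<Sum>j. F c j)" for c
  proof -
    have "lp_norm (ps j) \<Omega> (\<lambda>z. f z - (f z + complex_of_real c * h z)) = \<bar>c\<bar> * a j" for j
      using lp_norm_cmult[OF OLp_below_borel_measurable[OF h \<Omega>], of \<Omega> "ps j" "- complex_of_real c"]
        \<Omega> exponent_gt_1[OF ps(2,1), of j] by (simp add: a_def)
    then show ?thesis
      by (simp add: OLp_dist_def F_def)
  qed
  have bound: "norm (F c j) \<le> (1/2) ^ Suc j" for c j
  proof -
    have "(1/2) ^ Suc j * (\<bar>c\<bar> * a j / (1 + \<bar>c\<bar> * a j)) \<le> (1/2) ^ Suc j * 1"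
      using pos[of c j] by (intro mult_left_mono) auto
    then show ?thesis
      unfolding F_def using a[of j] by (simp add: abs_mult)
  qed
  have "uniform_limit UNIV (\<lambda>n c. \<Sum>j<n. F c j) (\<lambda>c. \<Sum>j. F c j) sequentially"
    using bound sums_summable[OF power_half_series] by (intro Weierstrass_m_test)
  moreover have "continuous_on UNIV (\<lambda>c. \<Sum>j<n. F c j)" for n
    unfolding F_def using pos by (intro continuous_intros) (metis less_irrefl)
  ultimately have "continuous_on UNIV (\<lambda>c. \<Sum>j. F c j)"
    by (intro uniform_limit_theorem[where F = sequentially]) auto
  then have "((\<lambda>c. \<Sum>j. F c j) \<longlongrightarrow> (\<Sum>j. F 0 j)) (at_right 0)"
    by (meson UNIV_I continuous_on_def tendsto_within_subset subset_UNIV)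
  then show ?thesis
    by (simp add: eq F_def)
qed

lemma totally_unbounded_iff_dense:
  fixes \<Omega> :: "(complex ^ 'n::finite) set"
  assumes \<Omega>: "convex \<Omega>" and D: "D \<subseteq> frontier \<Omega>" "frontier \<Omega> \<subseteq> closure D"
  shows "totally_unbounded \<Omega> f \<longleftrightarrow> (\<forall>w\<in>D. \<forall>k::nat. \<not> bounded (f ` (ball w (1 / real (Suc k)) \<inter> \<Omega>)))"
proof -
  have cc: "connected_component_set (ball w \<delta> \<inter> \<Omega>) x = ball w \<delta> \<inter> \<Omega>" if "x \<in> ball w \<delta> \<inter> \<Omega>" for w \<delta> x
    using that \<Omega> by (intro connected_component_eq_self convex_connected convex_Int) auto
  have ne: "ball w \<delta> \<inter> \<Omega> \<noteq> {}" if "w \<in> frontier \<Omega>" "\<delta> > 0" for w \<delta>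
    using that closure_approachable[of w \<Omega>] by (force simp: frontier_def dist_commute)
  have tu: "totally_unbounded \<Omega> f \<longleftrightarrow> (\<forall>w\<in>frontier \<Omega>. \<forall>\<delta>>0. \<not> bounded (f ` (ball w \<delta> \<inter> \<Omega>)))"
    unfolding totally_unbounded_def using cc ne by (metis all_not_in_conv)
  show ?thesis
    unfolding tu
  proof safe
    fix w k assume *: "\<forall>w\<in>frontier \<Omega>. \<forall>\<delta>>0. \<not> bounded (f ` (ball w \<delta> \<inter> \<Omega>))" "w \<in> D"
      "bounded (f ` (ball w (1 / real (Suc k)) \<inter> \<Omega>))"
    moreover have "1 / real (Suc k) > 0"
      by simp
    ultimately show False
      using D(1) by blast
  next
    fix u \<delta> assume *: "\<forall>w\<in>D. \<forall>k. \<not> bounded (f ` (ball w (1 / real (Suc k)) \<inter> \<Omega>))"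
      "u \<in> frontier \<Omega>" "(0::real) < \<delta>" "bounded (f ` (ball u \<delta> \<inter> \<Omega>))"
    obtain w where w: "w \<in> D" "dist w u < \<delta> / 2"
      using D(2) *(2,3) closure_approachable[of u D] by (meson half_gt_zero subsetD)
    obtain k where k: "1 / real (Suc k) < \<delta> / 2"
      using reals_Archimedean[of "\<delta> / 2"] *(3) by (auto simp: inverse_eq_divide)
    have "ball w (1 / real (Suc k)) \<subseteq> ball u \<delta>"
    proof
      fix x assume "x \<in> ball w (1 / real (Suc k))"
      then show "x \<in> ball u \<delta>"
        using w(2) k dist_triangle[of u x w] by (simp add: dist_commute)
    qed
    then have "bounded (f ` (ball w (1 / real (Suc k)) \<inter> \<Omega>))"
      using *(4) by (elim bounded_subset) auto
    with *(1) w(1) show False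
      by blast
  qed
qed

lemma not_bounded_image_iff:
  fixes f :: "'a \<Rightarrow> 'b::real_normed_vector"
  shows "\<not> bounded (f ` E) \<longleftrightarrow> (\<forall>m::nat. \<exists>z\<in>E. real m < norm (f z))"
proof -
  have "bounded (f ` E) \<longleftrightarrow> (\<exists>m::nat. \<forall>z\<in>E. norm (f z) \<le> real m)"
  proof
    assume "bounded (f ` E)"
    then obtain B where B: "\<And>z. z \<in> E \<Longrightarrow> norm (f z) \<le> B"
      by (auto simp: bounded_iff)
    obtain m :: nat where "B \<le> real m"
      using real_arch_simple by blast
    with B show "\<exists>m::nat. \<forall>z\<in>E. norm (f z) \<le> real m"
      by (meson order_trans)
  qed (auto simp: bounded_iff)
  then show ?thesis
    by (simp add: not_le)
qed

lemma exists_totally_unbounded: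
  fixes \<Omega> :: "(complex ^ 'n::finite) set"
  assumes \<Omega>: "bounded \<Omega>" "open \<Omega>" "convex \<Omega>"
  obtains h where "h \<in> OLp_below q \<Omega>" "totally_unbounded \<Omega> h"
proof (cases "\<Omega> = {}")
  case True
  then have "(\<lambda>z. 0) \<in> OLp_below q \<Omega>" "totally_unbounded \<Omega> (\<lambda>z. 0)"
    by (auto simp: OLp_below_def holo_on_def lp_int_def totally_unbounded_def)
  then show ?thesis
    by (rule that)
next
  case False
  then obtain h C where h: "holo_on \<Omega> h" "\<And>z. z \<notin> \<Omega> \<Longrightarrow> h z = 0" "C > 0"
    "\<And>z r. r > 0 \<Longrightarrow> ball z r \<subseteq> \<Omega> \<Longrightarrow> norm (h z) \<le> ln (C / r) + pi"
    "\<And>w \<delta>. w \<in> frontier \<Omega> \<Longrightarrow> \<delta> > 0 \<Longrightarrow> \<not> bounded (h ` (ball w \<delta> \<inter> \<Omega>))"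
    using exists_unbounded_log_bounded[OF \<Omega>] by metis
  have "lp_int p \<Omega> h < \<infinity>" if "p \<ge> 1" for p
    using log_bounded_imp_lp_int_finite[OF \<Omega> False h(3) that h(4)] .
  then have "h \<in> OLp_below q \<Omega>"
    using h(1,2) by (auto simp: OLp_below_def)
  moreover have "totally_unbounded \<Omega> h"
    using h(5) by (subst totally_unbounded_iff_dense[OF \<Omega>(3), of "frontier \<Omega>"]) (auto simp: closure_subset)
  ultimately show ?thesis
    by (rule that)
qed

text \<open>Two different exceptional \<open>c\<close> for the same set \<open>E\<close> would make \<open>h\<close> itself bounded on \<open>E\<close>.\<close>

lemma countable_bounded_perturbations:
  fixes f h :: "'a \<Rightarrow> complex"
  assumes "countable I" "\<And>i. i \<in> I \<Longrightarrow> \<not> bounded (h ` E i)"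
  shows "countable {c::real. \<exists>i\<in>I. bounded ((\<lambda>z. f z + complex_of_real c * h z) ` E i)}"
proof -
  have unique: "c = c'" if i: "i \<in> I" and b: "bounded ((\<lambda>z. f z + complex_of_real c * h z) ` E i)"
      "bounded ((\<lambda>z. f z + complex_of_real c' * h z) ` E i)" for i and c c' :: real
  proof (rule ccontr)
    assume "c \<noteq> c'"
    have "bounded ((\<lambda>z. (f z + complex_of_real c * h z) - (f z + complex_of_real c' * h z)) ` E i)"
      using b by (rule bounded_minus_comp)
    then have "bounded ((\<lambda>x. (1 / (complex_of_real (c - c'))) * x) `
        (\<lambda>z. (f z + complex_of_real c * h z) - (f z + complex_of_real c' * h z)) ` E i)"
      by (rule bounded_linear_image) (rule bounded_linear_mult_right)
    also have "(\<lambda>x. (1 / (complex_of_real (c - c'))) * x) `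
        (\<lambda>z. (f z + complex_of_real c * h z) - (f z + complex_of_real c' * h z)) ` E i = h ` E i"
      unfolding image_image using \<open>c \<noteq> c'\<close> by (intro image_cong) (auto simp: field_simps)
    finally show False
      using assms(2)[OF i] by simp
  qed
  have "countable {c::real. bounded ((\<lambda>z. f z + complex_of_real c * h z) ` E i)}" if "i \<in> I" for i
  proof (cases "\<exists>c::real. bounded ((\<lambda>z. f z + complex_of_real c * h z) ` E i)")
    case True
    then obtain c where "bounded ((\<lambda>z. f z + complex_of_real c * h z) ` E i)" ..
    then have "{c. bounded ((\<lambda>z. f z + complex_of_real c * h z) ` E i)} \<subseteq> {c}"
      using unique[OF that] by auto
    then show ?thesis
      by (rule countable_subset) simp
  next
    case False
    then have "{c. bounded ((\<lambda>z. f z + complex_of_real c * h z) ` E i)} = {}"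
      by auto
    then show ?thesis
      by (metis countable_empty)
  qed
  then have "countable (\<Union>i\<in>I. {c::real. bounded ((\<lambda>z. f z + complex_of_real c * h z) ` E i)})"
    using assms(1) by blast
  also have "\<dots> = {c::real. \<exists>i\<in>I. bounded ((\<lambda>z. f z + complex_of_real c * h z) ` E i)}"
    by auto
  finally show ?thesis .
qed

theorem theorem14:
  fixes \<Omega> :: "(complex ^ 'n::finite) set" and q :: ereal and ps :: "nat \<Rightarrow> real"
  assumes "bounded \<Omega>" "open \<Omega>" "convex \<Omega>"
    and "1 < q"
    and "1 < ps 0" "strict_mono ps" "(\<lambda>j. ereal (ps j)) \<longlonglongrightarrow> q"
  shows "Metric_space.mtopology (OLp_below q \<Omega>) (OLp_dist ps \<Omega>) closure_of
           {g \<in> OLp_below q \<Omega>. totally_unbounded \<Omega> g} = OLp_below q \<Omega>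
       \<and> gdelta_in (Metric_space.mtopology (OLp_below q \<Omega>) (OLp_dist ps \<Omega>))
           {g \<in> OLp_below q \<Omega>. totally_unbounded \<Omega> g}"
proof
  let ?X = "OLp_below q \<Omega>" and ?d = "OLp_dist ps \<Omega>"
  interpret M: Metric_space ?X ?d
    using Metric_space_OLp_below assms by blast
  obtain D where D: "countable D" "D \<subseteq> frontier \<Omega>" "frontier \<Omega> \<subseteq> closure D"
    using separable by blast
  note tu = totally_unbounded_iff_dense[OF \<open>convex \<Omega>\<close> D(2,3)]
  define E where "E = (\<lambda>(w, k::nat). ball w (1 / real (Suc k)) \<inter> \<Omega>)"
  define I where "I = D \<times> (UNIV :: nat set)"
  have I: "countable I"
    using D(1) by (simp add: I_def)
  have tuE: "totally_unbounded \<Omega> f \<longleftrightarrow> (\<forall>i\<in>I. \<not> bounded (f ` E i))" for f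
    unfolding tu by (auto simp: E_def I_def)
  show "M.mtopology closure_of {g \<in> ?X. totally_unbounded \<Omega> g} = ?X"
  proof -
    obtain h where h: "h \<in> ?X" "totally_unbounded \<Omega> h"
      using exists_totally_unbounded[OF assms(1-3)] by metis
    have "\<exists>g\<in>{g \<in> ?X. totally_unbounded \<Omega> g}. g \<in> M.mball f r" if f: "f \<in> ?X" and "r > 0" for f r
    proof -
      define B where "B = {c. \<exists>i\<in>I. bounded ((\<lambda>z. f z + complex_of_real c * h z) ` E i)}"
      have "countable B"
        unfolding B_def using I h(2) by (intro countable_bounded_perturbations) (auto simp: tuE)
      have "\<forall>\<^sub>F c in at_right 0. ?d f (\<lambda>z. f z + complex_of_real c * h z) < r"
        using OLp_dist_perturbation_tendsto[OF assms(2,5,6) h(1)] \<open>r > 0\<close> by (rule order_tendstoD)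
      then obtain b where b: "b > 0" "\<And>c. 0 < c \<Longrightarrow> c < b \<Longrightarrow> ?d f (\<lambda>z. f z + complex_of_real c * h z) < r"
        unfolding eventually_at_right_field by blast
      have "\<not> {0<..<b} \<subseteq> B"
        using \<open>countable B\<close> countable_subset uncountable_open_interval b(1) by metis
      then obtain c where c: "0 < c" "c < b" "c \<notin> B"
        by (meson greaterThanLessThan_iff subsetI)
      have "(\<lambda>z. f z + complex_of_real c * h z) \<in> ?X"
        using f h(1) assms(2) by (intro OLp_below_add OLp_below_cmult)
      moreover have "totally_unbounded \<Omega> (\<lambda>z. f z + complex_of_real c * h z)"
        using c(3) by (auto simp: tuE B_def)
      ultimately show ?thesis
        using b(2)[OF c(1,2)] f by auto
    qed
    then show ?thesis
      unfolding M.metric_closure_of by blast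
  qed
  have "{g \<in> ?X. totally_unbounded \<Omega> g} =
    \<Inter> (insert ?X ((\<lambda>(i, m::nat). {g \<in> ?X. \<exists>z\<in>E i. real m < norm (g z)}) ` (I \<times> UNIV)))"
    unfolding tuE not_bounded_image_iff by auto
  moreover have "gdelta_in M.mtopology
    (\<Inter> (insert ?X ((\<lambda>(i, m::nat). {g \<in> ?X. \<exists>z\<in>E i. real m < norm (g z)}) ` (I \<times> UNIV))))"
  proof (rule gdelta_in_Inter)
    show "countable (insert ?X ((\<lambda>(i, m::nat). {g \<in> ?X. \<exists>z\<in>E i. real m < norm (g z)}) ` (I \<times> UNIV)))"
      using I by auto
    fix S assume "S \<in> insert ?X ((\<lambda>(i, m::nat). {g \<in> ?X. \<exists>z\<in>E i. real m < norm (g z)}) ` (I \<times> UNIV))"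
    then consider "S = ?X" | i m where "S = {g \<in> ?X. \<exists>z\<in>E i. real m < norm (g z)}"
      by auto
    then show "gdelta_in M.mtopology S"
    proof cases
      case 1
      then show ?thesis
        using gdelta_in_topspace[of M.mtopology] by simp
    next
      case 2
      have "open (E i)" "E i \<subseteq> \<Omega>"
        using assms(2) by (auto simp: E_def split: prod.split)
      then show ?thesis
        unfolding 2 using openin_exceeds[OF assms(2,5-7)] by (intro open_imp_gdelta_in)
    qed
  qed auto
  ultimately show "gdelta_in M.mtopology {g \<in> ?X. totally_unbounded \<Omega> g}"
    by simp
qed

end
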